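(* Let $X_1,\dots,X_d$ be $\mathbf{P}_\eta$-a.s. distinct for any $\eta\in\{0,1\}^d$ such that $|\eta|_{0} = s$. Assume that the MLR property holds. Then $$\inf_{\tilde{\eta}} \sup_{|\eta|_{0} = s} \mathbf{E}_{\eta} |\tilde{\eta} - \eta| \ge \inf_{\tilde{\eta}} \sup_{|\eta|_{0} = s}\mathbf{P}_\eta(S_{\tilde\eta} \ne S_\eta) \ge \mathbf{P}_{e(s)}\Big(\min_{j=1,\dots,s}X_{j} \leq \max_{j=s+1,\dots,d} X_j \Big),$$ where $e(s)=(1,\dots,1,0,\dots,0)$ is the vector with $s$ ones followed by $d-s$ zeros. Furthermore, if $2\le s\le d-2$ and $F^{-1}_{0}(1-1/(d-s)) > F^{-1}_{1}(1/s)$, then $$\inf_{\tilde{\eta}} \sup_{|\eta|_{0} = s} \mathbf{E}_{\eta} |\tilde{\eta} - \eta| \ge \inf_{\tilde{\eta}} \sup_{|\eta|_{0} = s}\mathbf{P}_\eta(S_{\tilde\eta} \ne S_\eta) \geq (1-e^{-1})^2.$$ That is, for a sequence $(s_d)_{d\ge1}$ such that $2\le s_d\le d-2$ for all large $d$ and such that, for each $d$, the MLR property holds and $X_1,\dots,X_d$ are $\mathbf{P}_\eta$-a.s. distinct for any $\eta\in\{0,1\}^d$ with $|\eta|_0=s_d$, the condition that $F^{-1}_{0}(1-1/(d-s_d)) \leq F^{-1}_{1}(1/s_d)$ for all $d$ large enough is necessary for the existence of a selector achieving exact recovery.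
   Context: Pivotal selection problem: $d>2$ and $1\le s<d$ are integers; $P_0\neq P_1$ are probability measures with densities $f_0,f_1$ with respect to a common dominating measure $\mu$ and with c.d.f.s $F_0,F_1$ (in the sequence statement, $P_0,P_1$ may depend on $d$). For $\eta\in\{0,1\}^d$, under $\mathbf{P}_\eta$ the observations $X_1,\dots,X_d$ are independent, with $X_j\sim P_1$ if $\eta_j=1$ and $X_j\sim P_0$ if $\eta_j=0$; $\mathbf{E}_\eta$ is the corresponding expectation. A selector is any measurable function $\tilde\eta=\tilde\eta(X_1,\dots,X_d,\zeta)$ with values in $\{0,1\}^d$, where $\zeta$ is a randomization variable independent of $(X_1,\dots,X_d)$; $\inf_{\tilde\eta}$ is over all selectors. $|\tilde\eta-\eta|=\sum_{j=1}^d\mathbf{1}(\tilde\eta_j\ne\eta_j)$; $S_\eta=\{j:\eta_j\neq0\}$; $|\eta|_0=|S_\eta|$; $\sup_{|\eta|_0=s}$ is over $\eta\in\{0,1\}^d$ with $|\eta|_0=s$. For $i=0,1$ and $t\in(0,1)$, $F_i^{-1}(t)=\min\{v:F_i(v)=t\}$. MLR property: the observations take values in a subset of $\mathbb{R}$, the densities $f_0$ and $f_1$ have the same support, and $f_1/f_0$ is a (strictly) increasing function on the support of the densities. Exact recovery: a selector $\hat\eta$ (one for each $d$) achieves exact recovery for $(s_d)$ if $\limsup_{d\to\infty}\sup_{|\eta|_0=s_d}\mathbf{E}_\eta|\hat\eta-\eta|=0$. *)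

theory Defs
  imports "HOL-Probability.Probability"
begin

text \<open>Coordinates are indexed by \<open>{1..d}\<close>; vectors are extensional functions on this set.\<close>

definition binary_vectors :: "nat \<Rightarrow> (nat \<Rightarrow> nat) set" where
  "binary_vectors d = {1..d} \<rightarrow>\<^sub>E {0, 1}"

definition supp :: "nat \<Rightarrow> (nat \<Rightarrow> nat) \<Rightarrow> nat set" where
  "supp d \<eta> = {j \<in> {1..d}. \<eta> j \<noteq> 0}"

definition sparse_vectors :: "nat \<Rightarrow> nat \<Rightarrow> (nat \<Rightarrow> nat) set" where
  "sparse_vectors d s = {\<eta> \<in> binary_vectors d. card (supp d \<eta>) = s}"

definition first_ones :: "nat \<Rightarrow> nat \<Rightarrow> nat \<Rightarrow> nat" where
  "first_ones d s = (\<lambda>j\<in>{1..d}. if j \<le> s then 1 else 0)"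

definition hamming :: "nat \<Rightarrow> (nat \<Rightarrow> nat) \<Rightarrow> (nat \<Rightarrow> nat) \<Rightarrow> real" where
  "hamming d a b = (\<Sum>j\<in>{1..d}. of_bool (a j \<noteq> b j))"

definition selection_problem ::
    "nat \<Rightarrow> nat \<Rightarrow> real measure \<Rightarrow> (real \<Rightarrow> real) \<Rightarrow> (real \<Rightarrow> real)
      \<Rightarrow> real measure \<Rightarrow> real measure \<Rightarrow> bool" where
  "selection_problem d s \<mu> f0 f1 P0 P1 \<longleftrightarrow>
     2 < d \<and> 1 \<le> s \<and> s < d \<and>
     real_distribution P0 \<and> real_distribution P1 \<and> P0 \<noteq> P1 \<and>
     sets \<mu> = sets borel \<and>
     f0 \<in> borel_measurable borel \<and> (\<forall>x. 0 \<le> f0 x) \<and> P0 = density \<mu> (\<lambda>x. ennreal (f0 x)) \<and>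
     f1 \<in> borel_measurable borel \<and> (\<forall>x. 0 \<le> f1 x) \<and> P1 = density \<mu> (\<lambda>x. ennreal (f1 x))"

text \<open>The support of a density is the set of points where it is positive, so that the
  likelihood ratio is well defined on it.\<close>

definition MLR :: "(real \<Rightarrow> real) \<Rightarrow> (real \<Rightarrow> real) \<Rightarrow> bool" where
  "MLR f0 f1 \<longleftrightarrow>
     {x. 0 < f0 x} = {x. 0 < f1 x} \<and> strict_mono_on {x. 0 < f0 x} (\<lambda>x. f1 x / f0 x)"

text \<open>The law of the observations \<open>(X\<^sub>1, \<dots>, X\<^sub>d)\<close> under the parameter \<open>\<eta>\<close>.\<close>

definition obs_law ::
    "nat \<Rightarrow> real measure \<Rightarrow> real measure \<Rightarrow> (nat \<Rightarrow> nat) \<Rightarrow> (nat \<Rightarrow> real) measure" where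
  "obs_law d P0 P1 \<eta> = (\<Pi>\<^sub>M j\<in>{1..d}. if \<eta> j = 1 then P1 else P0)"

definition as_distinct :: "nat \<Rightarrow> nat \<Rightarrow> real measure \<Rightarrow> real measure \<Rightarrow> bool" where
  "as_distinct d s P0 P1 \<longleftrightarrow>
     (\<forall>\<eta>\<in>sparse_vectors d s. AE x in obs_law d P0 P1 \<eta>. inj_on x {1..d})"

text \<open>A selector is given by the law of its randomization variable \<open>\<zeta>\<close>, on an arbitrary
  type \<open>'z\<close>, together with a measurable function of \<open>((X\<^sub>1, \<dots>, X\<^sub>d), \<zeta>)\<close>. Independence
  of \<open>\<zeta>\<close> and the observations is built in through the product measure in \<open>joint_law\<close>.\<close>

type_synonym 'z selector = "'z measure \<times> ((nat \<Rightarrow> real) \<times> 'z \<Rightarrow> nat \<Rightarrow> nat)"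

definition selectors :: "nat \<Rightarrow> 'z selector set" where
  "selectors d = {(Z, h). prob_space Z \<and>
     h \<in> measurable ((\<Pi>\<^sub>M j\<in>{1..d}. borel) \<Otimes>\<^sub>M Z) (count_space (binary_vectors d))}"

definition joint_law ::
    "nat \<Rightarrow> real measure \<Rightarrow> real measure \<Rightarrow> (nat \<Rightarrow> nat) \<Rightarrow> 'z measure
      \<Rightarrow> ((nat \<Rightarrow> real) \<times> 'z) measure" where
  "joint_law d P0 P1 \<eta> Z = obs_law d P0 P1 \<eta> \<Otimes>\<^sub>M Z"

definition hamming_risk ::
    "nat \<Rightarrow> real measure \<Rightarrow> real measure \<Rightarrow> 'z selector \<Rightarrow> (nat \<Rightarrow> nat) \<Rightarrow> real" where
  "hamming_risk d P0 P1 \<sigma> \<eta> =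
     (\<integral>\<omega>. hamming d (snd \<sigma> \<omega>) \<eta> \<partial>joint_law d P0 P1 \<eta> (fst \<sigma>))"

definition wrong_recovery_prob ::
    "nat \<Rightarrow> real measure \<Rightarrow> real measure \<Rightarrow> 'z selector \<Rightarrow> (nat \<Rightarrow> nat) \<Rightarrow> real" where
  "wrong_recovery_prob d P0 P1 \<sigma> \<eta> =
     measure (joint_law d P0 P1 \<eta> (fst \<sigma>))
       {\<omega> \<in> space (joint_law d P0 P1 \<eta> (fst \<sigma>)). supp d (snd \<sigma> \<omega>) \<noteq> supp d \<eta>}"

text \<open>\<open>LEAST\<close> is the minimum of \<open>{v. cdf P v = t}\<close>. It exists for every \<open>t\<close> strictly between
  0 and 1 as soon as \<open>P\<close> has no atoms.\<close>

definition quantile :: "real measure \<Rightarrow> real \<Rightarrow> real" where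
  "quantile P t = (LEAST v. cdf P v = t)"

text \<open>Both risks are bounded by \<open>max 1 d\<close> and nonnegative, and there are finitely many
  parameters, so the real-valued suprema and infima over nonempty sets are genuine.\<close>

definition exact_recovery ::
    "(nat \<Rightarrow> nat) \<Rightarrow> (nat \<Rightarrow> real measure) \<Rightarrow> (nat \<Rightarrow> real measure) \<Rightarrow> (nat \<Rightarrow> 'z selector) \<Rightarrow> bool"
  where
  "exact_recovery s P0 P1 \<sigma> \<longleftrightarrow>
     (\<forall>d>2. \<sigma> d \<in> selectors d) \<and>
     limsup (\<lambda>d. ereal (SUP \<eta>\<in>sparse_vectors d (s d). hamming_risk d (P0 d) (P1 d) (\<sigma> d) \<eta>)) = 0"

end

theory Submission
  imports Defs
begin

text \<open>
  The minimax risk is at least the Bayes risk for the uniform prior on the sparse vectors.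
  With respect to the law of \<open>d\<close> observations from \<open>P0\<close>, the likelihood of \<open>\<eta>\<close> is the product of
  \<open>r = f1 / f0\<close> over the support of \<open>\<eta>\<close>. Since \<open>r\<close> is increasing, it is maximised by selecting the
  \<open>s\<close> largest observations, so the Bayes success probability is, by symmetry, the probability under
  \<open>first_ones d s\<close> that all signal observations exceed all noise observations. If
  \<open>u = quantile P1 (1 / s)\<close> is smaller than \<open>v = quantile P0 (1 - 1 / (d - s))\<close>, this
  separation fails whenever some signal observation is at most \<open>u\<close> and some noise observation
  exceeds \<open>v\<close>: two independent events of probability at least \<open>1 - exp (- 1)\<close> each.
\<close>

section \<open>Densities on finite product spaces\<close>

text \<open>Measures on a finite product are determined by their values on rectangles. On a
  rectangle the integrand times the indicator is a product of one-coordinate functions, so the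
  integral factorises.\<close>

lemma density_PiM:
  fixes M :: "'i \<Rightarrow> 'a measure"
  assumes "finite I" and "product_sigma_finite M"
    and "product_sigma_finite (\<lambda>i. density (M i) (f i))"
    and f: "\<And>i. f i \<in> borel_measurable (M i)"
  shows "density (PiM I M) (\<lambda>x. \<Prod>i\<in>I. f i (x i)) = PiM I (\<lambda>i. density (M i) (f i))"
proof -
  interpret M: product_sigma_finite M by fact
  interpret D: product_sigma_finite "\<lambda>i. density (M i) (f i)" by fact
  note f[measurable]
  show ?thesis
  proof (rule D.PiM_eqI)
    show "sets (density (PiM I M) (\<lambda>x. \<Prod>i\<in>I. f i (x i))) = sets (PiM I (\<lambda>i. density (M i) (f i)))"
      by (simp cong: sets_PiM_cong)
    fix A assume A: "\<And>i. i \<in> I \<Longrightarrow> A i \<in> sets (density (M i) (f i))"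
    then have AM: "\<And>i. i \<in> I \<Longrightarrow> A i \<in> sets (M i)" by simp
    have PiE: "Pi\<^sub>E I A \<in> sets (PiM I M)"
      using AM \<open>finite I\<close> by (intro sets_PiM_I_finite) auto
    have "emeasure (density (PiM I M) (\<lambda>x. \<Prod>i\<in>I. f i (x i))) (Pi\<^sub>E I A)
        = (\<integral>\<^sup>+x. (\<Prod>i\<in>I. f i (x i)) * indicator (Pi\<^sub>E I A) x \<partial>PiM I M)"
      using PiE by (subst emeasure_density) auto
    also have "\<dots> = (\<integral>\<^sup>+x. (\<Prod>i\<in>I. f i (x i) * indicator (A i) (x i)) \<partial>PiM I M)"
    proof (rule nn_integral_cong)
      fix x assume "x \<in> space (PiM I M)"
      then have "indicator (Pi\<^sub>E I A) x = (\<Prod>i\<in>I. indicator (A i) (x i) :: ennreal)"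
        using \<open>finite I\<close>
        by (auto simp: indicator_def space_PiM PiE_iff)
      then show "(\<Prod>i\<in>I. f i (x i)) * indicator (Pi\<^sub>E I A) x
          = (\<Prod>i\<in>I. f i (x i) * indicator (A i) (x i))"
        by (simp add: prod.distrib)
    qed
    also have "\<dots> = (\<Prod>i\<in>I. \<integral>\<^sup>+x. f i x * indicator (A i) x \<partial>M i)"
      using AM \<open>finite I\<close> by (intro M.product_nn_integral_prod) auto
    also have "\<dots> = (\<Prod>i\<in>I. emeasure (density (M i) (f i)) (A i))"
      using AM by (intro prod.cong refl) (simp add: emeasure_density)
    finally show "emeasure (density (PiM I M) (\<lambda>x. \<Prod>i\<in>I. f i (x i))) (Pi\<^sub>E I A)
        = (\<Prod>i\<in>I. emeasure (density (M i) (f i)) (A i))" .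
  qed fact
qed

section \<open>Sparse vectors and selectors\<close>

lemma finite_sparse_vectors: "finite (sparse_vectors d s)"
proof -
  have "finite (binary_vectors d)"
    unfolding binary_vectors_def by (intro finite_PiE) auto
  then show ?thesis by (simp add: sparse_vectors_def)
qed

lemma finite_supp: "finite (supp d \<eta>)"
  by (simp add: supp_def)

lemma supp_first_ones: "s \<le> d \<Longrightarrow> supp d (first_ones d s) = {1..s}"
proof (intro set_eqI)
  fix j assume "s \<le> d"
  then show "j \<in> supp d (first_ones d s) \<longleftrightarrow> j \<in> {1..s}"
    by (cases "j \<le> s") (auto simp: supp_def first_ones_def)
qed

lemma first_ones_sparse: "s \<le> d \<Longrightarrow> first_ones d s \<in> sparse_vectors d s"
proof -
  assume "s \<le> d"
  moreover have "first_ones d s \<in> binary_vectors d"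
    by (auto simp: binary_vectors_def first_ones_def)
  ultimately show ?thesis by (simp add: sparse_vectors_def supp_first_ones)
qed

text \<open>Entries are 0 or 1 on the index set and fixed outside it. Recovery of the support can
  therefore be treated as recovery of the whole vector.\<close>

lemma supp_inj_on: "inj_on (supp d) (binary_vectors d)"
proof (rule inj_onI)
  fix \<eta> \<eta>' assume *: "\<eta> \<in> binary_vectors d" "\<eta>' \<in> binary_vectors d" "supp d \<eta> = supp d \<eta>'"
  show "\<eta> = \<eta>'"
  proof (rule PiE_ext)
    show "\<eta> \<in> {1..d} \<rightarrow>\<^sub>E {0,1}" "\<eta>' \<in> {1..d} \<rightarrow>\<^sub>E {0,1}"
      using * by (auto simp: binary_vectors_def)
    fix j assume "j \<in> {1..d}"
    moreover from this have "\<eta> j \<in> {0,1}" "\<eta>' j \<in> {0,1}"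
      using * by (auto simp: binary_vectors_def)
    moreover have "j \<in> supp d \<eta> \<longleftrightarrow> j \<in> supp d \<eta>'" using * by simp
    ultimately show "\<eta> j = \<eta>' j" by (auto simp: supp_def)
  qed
qed

text \<open>A real infimum over an empty set would carry no information. The constant zero vector
  with a point mass as randomization is available for every type \<open>'z\<close>.\<close>

lemma selectors_nonempty: "(selectors d :: 'z selector set) \<noteq> {}"
proof -
  have "(\<lambda>j\<in>{1..d}. 0) \<in> binary_vectors d"
    by (auto simp: binary_vectors_def)
  then have "(return (count_space UNIV) (undefined :: 'z), \<lambda>_. \<lambda>j\<in>{1..d}. 0) \<in> selectors d"
    unfolding selectors_def by (auto intro!: prob_space_return)
  then show ?thesis by blast
qed

section \<open>An exponential bound, and quantiles of atomless laws\<close>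

lemma one_minus_inverse_power_le:
  assumes "1 \<le> n" shows "(1 - 1 / real n) ^ n \<le> exp (- 1)"
  using exp_ge_one_minus_x_over_n_power_n[of 1 n] assms by simp

text \<open>Without atoms the cdf is continuous, so its level set at \<open>t\<close> is closed, and
  nonempty by the intermediate value theorem. It is bounded below because the cdf tends to 0 at the
  left. Hence its infimum is attained and is the \<open>LEAST\<close> element.\<close>

lemma (in real_distribution) cdf_quantile:
  assumes atomless: "\<And>x. measure M {x} = 0" and t: "0 < t" "t < 1"
  shows "cdf M (quantile M t) = t"
proof -
  let ?A = "{v. cdf M v = t}"
  have cont: "continuous_on UNIV (cdf M)"
    using atomless isCont_cdf by (simp add: continuous_on_eq_continuous_at)
  have "\<forall>\<^sub>F x in at_bot. cdf M x < t"
    using cdf_lim_at_bot t by (auto simp: order_tendsto_iff)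
  then obtain a where a: "\<And>x. x \<le> a \<Longrightarrow> cdf M x < t" by (auto simp: eventually_at_bot_linorder)
  have "\<forall>\<^sub>F x in at_top. cdf M x > t"
    using cdf_lim_at_top_prob t by (auto simp: order_tendsto_iff)
  then obtain b where b: "\<And>x. b \<le> x \<Longrightarrow> t < cdf M x" by (auto simp: eventually_at_top_linorder)
  \<comment> \<open>The endpoint \<open>max a b\<close> avoids comparing \<open>a\<close> with
    \<open>b\<close>; the cdf still exceeds \<open>t\<close> there.\<close>
  have "\<exists>x\<ge>a. x \<le> max a b \<and> cdf M x = t"
    using a[of a] b[of "max a b"] cont by (intro IVT') (auto intro: continuous_on_subset)
  then have ne: "?A \<noteq> {}" by auto
  have "closed (cdf M -` {t})"
    using cont by (intro closed_vimage) (auto simp: continuous_on_eq_continuous_at)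
  then have "closed ?A" by (simp add: vimage_def)
  moreover have bdd: "bdd_below ?A"
    using a by (intro bdd_belowI[of _ a]) (metis (mono_tags) mem_Collect_eq less_irrefl linear)
  ultimately have Inf: "Inf ?A \<in> ?A" using ne by (intro closed_contains_Inf)
  then have "quantile M t = Inf ?A"
    unfolding quantile_def using bdd by (intro Least_equality) (auto intro: cInf_lower)
  with Inf show ?thesis by simp
qed

section \<open>The event that signal exceeds noise\<close>

text \<open>Pairwise comparisons, rather than a minimum and a maximum, make measurability a matter
  of finitely many conditions and let permutations of the coordinates act directly.\<close>

definition separated :: "nat \<Rightarrow> (nat \<Rightarrow> nat) \<Rightarrow> (nat \<Rightarrow> real) set" where
  "separated d \<eta> = {x \<in> space (\<Pi>\<^sub>M j\<in>{1..d}. borel).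
     \<forall>i\<in>supp d \<eta>. \<forall>j\<in>{1..d} - supp d \<eta>. x j < x i}"

lemma separated_measurable [measurable]: "separated d \<eta> \<in> sets (\<Pi>\<^sub>M j\<in>{1..d}. borel)"
proof -
  have "{x \<in> space (\<Pi>\<^sub>M j\<in>{1..d}. borel). x j < (x i :: real)} \<in> sets (\<Pi>\<^sub>M j\<in>{1..d}. borel)"
    if "i \<in> {1..d}" "j \<in> {1..d}" for i j
    using that by measurable
  then show ?thesis
    unfolding separated_def
    by (intro sets.sets_Collect_finite_All finite_supp finite_Diff finite_atLeastAtMost)
       (auto simp: supp_def)
qed

text \<open>The bounds on \<open>s\<close> make both index ranges nonempty, so \<open>Min\<close>
  and \<open>Max\<close> have genuine values and comparing them amounts to comparing all
  pairs.\<close>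

lemma separated_first_ones:
  assumes "1 \<le> s" "s < d"
  shows "separated d (first_ones d s) = space (\<Pi>\<^sub>M j\<in>{1..d}. borel) -
    {x \<in> space (\<Pi>\<^sub>M j\<in>{1..d}. borel). (MIN j\<in>{1..s}. x j) \<le> (MAX j\<in>{s+1..d}. x j)}"
proof -
  have "(\<forall>i\<in>supp d (first_ones d s). \<forall>j\<in>{1..d} - supp d (first_ones d s). x j < x i) \<longleftrightarrow>
      \<not> (MIN j\<in>{1..s}. x j) \<le> (MAX j\<in>{s+1..d}. x j)" for x :: "nat \<Rightarrow> real"
  proof -
    have "{1..s} \<noteq> {}" "{s+1..d} \<noteq> {}" using assms by auto
    then have "\<not> (MIN j\<in>{1..s}. x j) \<le> (MAX j\<in>{s+1..d}. x j) \<longleftrightarrow>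
        (\<forall>i\<in>{1..s}. \<forall>j\<in>{s+1..d}. x j < x i)"
      by (simp only: not_le Min_gr_iff Max_less_iff finite_imageI finite_atLeastAtMost
          image_is_empty ball_simps not_False_eq_True) blast
    moreover have "supp d (first_ones d s) = {1..s}" "{1..d} - {1..s} = {s+1..d}"
      using assms by (auto simp: supp_first_ones)
    ultimately show ?thesis by (simp only:)
  qed
  then show ?thesis
    unfolding separated_def by blast
qed

section \<open>Likelihoods relative to pure noise\<close>

text \<open>With a common support, \<open>P1\<close> has a density with respect to
  \<open>P0\<close>, so the dominating measure disappears and only the ratio \<open>r\<close>
  remains. For \<open>r = f1 / f0\<close> the ratio is 0 off the support, so
  \<open>{x. 0 < r x}\<close> is the support itself.\<close>

locale monotone_selection =
  fixes d s :: nat and P0 P1 :: "real measure" and r :: "real \<Rightarrow> real"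
  assumes s: "1 \<le> s" "s < d"
    and P0: "real_distribution P0" and P1: "real_distribution P1"
    and r_measurable [measurable]: "r \<in> borel_measurable borel"
    and r_nonneg: "\<And>x. 0 \<le> r x"
    and r_pos: "AE x in P0. 0 < r x"
    and r_mono: "strict_mono_on {x. 0 < r x} r"
    and P1_density: "P1 = density P0 (\<lambda>x. ennreal (r x))"
    and distinct: "as_distinct d s P0 P1"
begin

abbreviation "Sparse \<equiv> sparse_vectors d s"
abbreviation "obs \<equiv> obs_law d P0 P1"
abbreviation "Obs \<equiv> (\<Pi>\<^sub>M j\<in>{1..d}. borel) :: (nat \<Rightarrow> real) measure"
abbreviation "Q \<equiv> (\<Pi>\<^sub>M j\<in>{1..d}. P0)"

definition likelihood :: "(nat \<Rightarrow> nat) \<Rightarrow> (nat \<Rightarrow> real) \<Rightarrow> real" where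
  "likelihood \<eta> x = (\<Prod>j\<in>{1..d}. if \<eta> j = 1 then r (x j) else 1)"

sublocale P0: real_distribution P0 by (rule P0)
sublocale P1: real_distribution P1 by (rule P1)

lemma sets_Q [measurable_cong]: "sets Q = sets Obs"
  by (intro sets_PiM_cong) auto

lemma sets_obs [measurable_cong]: "sets (obs \<eta>) = sets Obs"
  unfolding obs_law_def by (intro sets_PiM_cong) auto

lemma space_obs: "space (obs \<eta>) = space Obs"
  by (rule sets_eq_imp_space_eq) (rule sets_obs)

sublocale obs: prob_space "obs_law d P0 P1 \<eta>" for \<eta>
  unfolding obs_law_def
  by (intro prob_space_PiM) (auto intro: P0.prob_space_axioms P1.prob_space_axioms)

lemma likelihood_measurable [measurable]: "likelihood \<eta> \<in> borel_measurable Obs"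
  unfolding likelihood_def by measurable

lemma likelihood_measurable_Q: "(\<lambda>x. ennreal (likelihood \<eta> x)) \<in> borel_measurable Q"
  unfolding measurable_cong_sets[OF sets_Q refl] by measurable

lemma likelihood_supp:
  assumes "\<eta> \<in> Sparse" shows "likelihood \<eta> x = (\<Prod>j\<in>supp d \<eta>. r (x j))"
  unfolding likelihood_def
proof (rule prod.mono_neutral_cong_right)
  show "\<forall>i\<in>{1..d} - supp d \<eta>. (if \<eta> i = 1 then r (x i) else 1) = 1"
    by (auto simp: supp_def)
  fix j assume "j \<in> supp d \<eta>"
  then have "\<eta> j \<noteq> 0" "\<eta> j \<in> {0, 1}"
    using assms by (auto simp: supp_def sparse_vectors_def binary_vectors_def dest: PiE_mem)
  then show "(if \<eta> j = 1 then r (x j) else 1) = r (x j)" by auto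
qed (auto simp: supp_def)

text \<open>Every coordinate law has a density with respect to \<open>P0\<close>: \<open>r\<close>
  for a signal and 1 for noise. \<open>density_PiM\<close> multiplies these densities.\<close>

lemma obs_density: "obs \<eta> = density Q (\<lambda>x. ennreal (likelihood \<eta> x))"
proof -
  let ?f = "\<lambda>j x. if \<eta> j = 1 then ennreal (r x) else 1"
  have eq: "(if \<eta> j = 1 then P1 else P0) = density P0 (?f j)" for j
    using P1_density by (auto simp: density_1)
  have ps: "prob_space (density P0 (?f j))" for j
    unfolding eq[symmetric] using P0.prob_space_axioms P1.prob_space_axioms by auto
  have "density Q (\<lambda>x. \<Prod>j\<in>{1..d}. ?f j (x j)) = (\<Pi>\<^sub>M j\<in>{1..d}. density P0 (?f j))"
  proof (rule density_PiM)
    show "product_sigma_finite (\<lambda>i. P0)"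
      unfolding product_sigma_finite_def by (auto intro: P0.sigma_finite_measure_axioms)
    show "product_sigma_finite (\<lambda>j. density P0 (?f j))"
      unfolding product_sigma_finite_def
      using ps prob_space_imp_sigma_finite by blast
  qed auto
  also have "\<dots> = obs \<eta>"
    unfolding obs_law_def by (intro PiM_cong refl) (simp only: eq)
  moreover have "(\<Prod>j\<in>{1..d}. ?f j (x j)) = ennreal (likelihood \<eta> x)" for x
    unfolding likelihood_def by (subst prod_ennreal[symmetric]) (auto intro!: prod.cong r_nonneg)
  ultimately show ?thesis by simp
qed

text \<open>Distinctness is assumed under sparse parameters, whereas \<open>Q\<close> is the law of
  pure noise. Since the likelihood of \<open>first_ones d s\<close> is positive
  \<open>Q\<close>-almost surely, null sets of its law are null sets of \<open>Q\<close>.\<close>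

lemma AE_regular: "AE x in Q. inj_on x {1..d} \<and> (\<forall>j\<in>{1..d}. 0 < r (x j))"
proof -
  have pos: "AE x in Q. \<forall>j\<in>{1..d}. 0 < r (x j)"
    by (intro AE_ball_countable' AE_PiM_component r_pos P0.prob_space_axioms) auto
  have "AE x in obs (first_ones d s). inj_on x {1..d}"
    using distinct first_ones_sparse s unfolding as_distinct_def by simp
  then have "AE x in Q. 0 < ennreal (likelihood (first_ones d s) x) \<longrightarrow> inj_on x {1..d}"
    unfolding obs_density by (subst (asm) AE_density[OF likelihood_measurable_Q])
  with pos show ?thesis
  proof eventually_elim
    case (elim x)
    then have "0 < likelihood (first_ones d s) x"
      unfolding likelihood_def by (intro prod_pos) auto
    with elim show ?case by simp
  qed
qed

text \<open>A maximum likelihood estimator cannot be improved by exchanging a selected and an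
  unselected coordinate, so it selects the \<open>s\<close> largest observations.\<close>

lemma maximum_likelihood_separated:
  assumes x: "x \<in> space Obs" and inj: "inj_on x {1..d}" and pos: "\<And>j. j \<in> {1..d} \<Longrightarrow> 0 < r (x j)"
  obtains \<eta> where "\<eta> \<in> Sparse" "x \<in> separated d \<eta>"
    "\<And>\<eta>'. \<eta>' \<in> Sparse \<Longrightarrow> likelihood \<eta>' x \<le> likelihood \<eta> x"
proof -
  have "Sparse \<noteq> {}" using first_ones_sparse[of s d] s by auto
  then have "Max ((\<lambda>\<eta>. likelihood \<eta> x) ` Sparse) \<in> (\<lambda>\<eta>. likelihood \<eta> x) ` Sparse"
    by (intro Max_in finite_imageI finite_sparse_vectors) auto
  then obtain \<eta> where \<eta>: "\<eta> \<in> Sparse"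
    and Max: "Max ((\<lambda>\<eta>. likelihood \<eta> x) ` Sparse) = likelihood \<eta> x" by auto
  have max: "likelihood \<eta>' x \<le> likelihood \<eta> x" if "\<eta>' \<in> Sparse" for \<eta>'
    unfolding Max[symmetric] using that by (intro Max_ge finite_imageI finite_sparse_vectors) auto
  have "x j < x i" if i: "i \<in> supp d \<eta>" and j: "j \<in> {1..d} - supp d \<eta>" for i j
  proof -
    define \<eta>' where "\<eta>' = \<eta>(i := 0, j := 1)"
    have ij: "i \<noteq> j" "i \<in> {1..d}" using i j by (auto simp: supp_def)
    have supp': "supp d \<eta>' = insert j (supp d \<eta> - {i})"
      using i j by (auto simp: supp_def \<eta>'_def)
    have "card (supp d \<eta>') = s"
      using i j \<eta> s unfolding supp' by (simp add: sparse_vectors_def finite_supp)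
    then have \<eta>': "\<eta>' \<in> Sparse"
      using \<eta> ij j by (auto simp: sparse_vectors_def binary_vectors_def \<eta>'_def PiE_iff extensional_def)
    \<comment> \<open>The two supports differ by one exchange, so the common positive factor
      \<open>?p\<close> cancels and maximality compares \<open>r (x j)\<close> with
      \<open>r (x i)\<close> alone.\<close>
    let ?p = "\<Prod>k\<in>supp d \<eta> - {i}. r (x k)"
    have "0 < ?p" by (intro prod_pos pos) (auto simp: supp_def)
    moreover have "likelihood \<eta> x = r (x i) * ?p"
      using i by (simp add: likelihood_supp[OF \<eta>] prod.remove finite_supp)
    moreover have "likelihood \<eta>' x = r (x j) * ?p"
      using j by (simp add: likelihood_supp[OF \<eta>'] supp' finite_supp)
    ultimately have "r (x j) \<le> r (x i)"
      using max[OF \<eta>'] by simp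
    moreover have "x i \<noteq> x j"
      using inj ij j by (auto dest: inj_onD)
    moreover have "0 < r (x i)" "0 < r (x j)" using pos ij j by auto
    \<comment> \<open>By strict monotonicity \<open>x i < x j\<close> would contradict this
      comparison, and equality is excluded by distinctness.\<close>
    ultimately show ?thesis
      using strict_mono_onD[OF r_mono, of "x i" "x j"] by (cases "x i < x j") auto
  qed
  then have "x \<in> separated d \<eta>"
    using x by (simp add: separated_def)
  with \<eta> max that show ?thesis by blast
qed

section \<open>The Bayes bound on success probabilities\<close>

text \<open>Given \<open>x\<close>, a selector distributes total probability at most 1 over the
  sparse vectors, so its likelihood-weighted success is at most the largest likelihood at
  \<open>x\<close>. That value is one of the terms on the right, because a maximiser separates
  \<open>x\<close>. Integrating over \<open>Q\<close> gives the bound; the uniform prior appears as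
  an unnormalised sum.\<close>

lemma sum_success_le:
  assumes "prob_space Z" and h: "h \<in> measurable (Obs \<Otimes>\<^sub>M Z) (count_space (binary_vectors d))"
  shows "(\<Sum>\<eta>\<in>Sparse. emeasure (obs \<eta> \<Otimes>\<^sub>M Z) {\<omega> \<in> space (Obs \<Otimes>\<^sub>M Z). h \<omega> = \<eta>})
    \<le> (\<Sum>\<eta>\<in>Sparse. emeasure (obs \<eta>) (separated d \<eta>))"
proof -
  interpret Z: prob_space Z by fact
  define C where "C \<eta> = {\<omega> \<in> space (Obs \<Otimes>\<^sub>M Z). h \<omega> = \<eta>}" for \<eta>
  have C: "C \<eta> \<in> sets (Obs \<Otimes>\<^sub>M Z)" if "\<eta> \<in> Sparse" for \<eta>
  proof -
    have "C \<eta> = h -` {\<eta>} \<inter> space (Obs \<Otimes>\<^sub>M Z)" by (auto simp: C_def)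
    then show ?thesis
      using measurable_sets[OF h, of "{\<eta>}"] that by (simp add: sparse_vectors_def)
  qed
  \<comment> \<open>The section of \<open>C \<eta>\<close> at \<open>x\<close> has as measure the
    conditional probability, over the randomization, of selecting \<eta> when \<open>x\<close> is
    observed.\<close>
  have Cm: "(\<lambda>x. emeasure Z (Pair x -` C \<eta>)) \<in> borel_measurable Obs" if "\<eta> \<in> Sparse" for \<eta>
    using Z.measurable_emeasure_Pair[OF C[OF that]] .
  then have CmQ: "(\<lambda>x. emeasure Z (Pair x -` C \<eta>)) \<in> borel_measurable Q" if "\<eta> \<in> Sparse" for \<eta>
    using that measurable_cong_sets[OF sets_Q refl] by blast
  have sep: "separated d \<eta> \<in> sets Q" for \<eta>
    unfolding sets_Q by (rule separated_measurable)
  have "emeasure (obs \<eta> \<Otimes>\<^sub>M Z) (C \<eta>)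
      = (\<integral>\<^sup>+x. ennreal (likelihood \<eta> x) * emeasure Z (Pair x -` C \<eta>) \<partial>Q)" if "\<eta> \<in> Sparse" for \<eta>
  proof -
    have "C \<eta> \<in> sets (obs \<eta> \<Otimes>\<^sub>M Z)"
      using C[OF that] sets_pair_measure_cong[OF sets_obs refl] by blast
    then have "emeasure (obs \<eta> \<Otimes>\<^sub>M Z) (C \<eta>) = (\<integral>\<^sup>+x. emeasure Z (Pair x -` C \<eta>) \<partial>obs \<eta>)"
      by (rule Z.emeasure_pair_measure_alt)
    also have "\<dots> = (\<integral>\<^sup>+x. ennreal (likelihood \<eta> x) * emeasure Z (Pair x -` C \<eta>) \<partial>Q)"
      unfolding obs_density using likelihood_measurable_Q CmQ[OF that] by (rule nn_integral_density)
    finally show ?thesis .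
  qed
  then have "(\<Sum>\<eta>\<in>Sparse. emeasure (obs \<eta> \<Otimes>\<^sub>M Z) (C \<eta>))
      = (\<Sum>\<eta>\<in>Sparse. \<integral>\<^sup>+x. ennreal (likelihood \<eta> x) * emeasure Z (Pair x -` C \<eta>) \<partial>Q)"
    by (intro sum.cong refl)
  also have "\<dots> = (\<integral>\<^sup>+x. (\<Sum>\<eta>\<in>Sparse. ennreal (likelihood \<eta> x) * emeasure Z (Pair x -` C \<eta>)) \<partial>Q)"
    by (intro nn_integral_sum[symmetric] borel_measurable_times_ennreal likelihood_measurable_Q CmQ)
  also have "\<dots> \<le> (\<integral>\<^sup>+x. (\<Sum>\<eta>\<in>Sparse. ennreal (likelihood \<eta> x) * indicator (separated d \<eta>) x) \<partial>Q)"
  proof (rule nn_integral_mono_AE)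
    show "AE x in Q. (\<Sum>\<eta>\<in>Sparse. ennreal (likelihood \<eta> x) * emeasure Z (Pair x -` C \<eta>))
        \<le> (\<Sum>\<eta>\<in>Sparse. ennreal (likelihood \<eta> x) * indicator (separated d \<eta>) x)"
      using AE_regular AE_space
    proof eventually_elim
      case (elim x)
      then have x: "x \<in> space Obs" using sets_eq_imp_space_eq[OF sets_Q] by simp
      obtain \<eta>\<^sub>0 where \<eta>\<^sub>0: "\<eta>\<^sub>0 \<in> Sparse" "x \<in> separated d \<eta>\<^sub>0"
        "\<And>\<eta>'. \<eta>' \<in> Sparse \<Longrightarrow> likelihood \<eta>' x \<le> likelihood \<eta>\<^sub>0 x"
        using maximum_likelihood_separated[OF x] elim by blast
      have "(\<Sum>\<eta>\<in>Sparse. ennreal (likelihood \<eta> x) * emeasure Z (Pair x -` C \<eta>))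
          \<le> (\<Sum>\<eta>\<in>Sparse. ennreal (likelihood \<eta>\<^sub>0 x) * emeasure Z (Pair x -` C \<eta>))"
        using \<eta>\<^sub>0(3) by (intro sum_mono mult_right_mono ennreal_leI) auto
      \<comment> \<open>Different values of \<eta> give disjoint sections, so their probabilities
        add up to that of the union.\<close>
      also have "\<dots> = ennreal (likelihood \<eta>\<^sub>0 x) * emeasure Z (\<Union>\<eta>\<in>Sparse. Pair x -` C \<eta>)"
      proof -
        have "(\<Sum>\<eta>\<in>Sparse. emeasure Z (Pair x -` C \<eta>)) = emeasure Z (\<Union>\<eta>\<in>Sparse. Pair x -` C \<eta>)"
        proof (intro sum_emeasure)
          show "disjoint_family_on (\<lambda>\<eta>. Pair x -` C \<eta>) Sparse"
            by (auto simp: disjoint_family_on_def C_def)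
        qed (use C in \<open>auto intro: sets_Pair1 simp: finite_sparse_vectors\<close>)
        then show ?thesis by (simp add: sum_distrib_left[symmetric])
      qed
      also have "\<dots> \<le> ennreal (likelihood \<eta>\<^sub>0 x) * 1"
        by (intro mult_left_mono Z.emeasure_le_1) auto
      also have "\<dots> = ennreal (likelihood \<eta>\<^sub>0 x) * indicator (separated d \<eta>\<^sub>0) x"
        using \<eta>\<^sub>0 by simp
      \<comment> \<open>All terms are nonnegative; the one for \<open>\<eta>\<^sub>0\<close> is
        already the left side.\<close>
      also have "\<dots> \<le> (\<Sum>\<eta>\<in>Sparse. ennreal (likelihood \<eta> x) * indicator (separated d \<eta>) x)"
        by (rule member_le_sum[OF \<eta>\<^sub>0(1)]) (auto simp: finite_sparse_vectors)
      finally show ?case .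
    qed
  qed
  also have "\<dots> = (\<Sum>\<eta>\<in>Sparse. \<integral>\<^sup>+x. ennreal (likelihood \<eta> x) * indicator (separated d \<eta>) x \<partial>Q)"
    by (intro nn_integral_sum borel_measurable_times_ennreal likelihood_measurable_Q
        borel_measurable_indicator sep)
  also have "\<dots> = (\<Sum>\<eta>\<in>Sparse. emeasure (obs \<eta>) (separated d \<eta>))"
    unfolding obs_density
    by (intro sum.cong refl emeasure_density[symmetric] likelihood_measurable_Q sep)
  finally show ?thesis unfolding C_def .
qed

text \<open>A permutation of the coordinates maps \<open>first_ones d s\<close> to \<open>\<eta>\<close>.\<close>

lemma prob_separated:
  assumes "\<eta> \<in> Sparse"
  shows "measure (obs \<eta>) (separated d \<eta>) = measure (obs (first_ones d s)) (separated d (first_ones d s))"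
proof -
  let ?e = "first_ones d s"
  have sub: "supp d \<zeta> \<subseteq> {1..d}" for \<zeta> by (auto simp: supp_def)
  have card: "card (supp d \<eta>) = card (supp d ?e)"
    using assms s by (simp add: sparse_vectors_def supp_first_ones)
  then have "card ({1..d} - supp d \<eta>) = card ({1..d} - supp d ?e)"
    by (simp only: card_Diff_subset[OF finite_supp sub])
  with card obtain f g where f: "bij_betw f (supp d ?e) (supp d \<eta>)"
    and g: "bij_betw g ({1..d} - supp d ?e) ({1..d} - supp d \<eta>)"
    by (metis finite_supp finite_atLeastAtMost finite_Diff finite_same_card_bij)
  \<comment> \<open>Glueing a bijection of the supports to one of their complements gives a
    permutation of \<open>{1..d}\<close> that preserves the roles of signal and noise.\<close>
  define t where "t j = (if j \<in> supp d ?e then f j else g j)" for j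
  have t1: "bij_betw t (supp d ?e) (supp d \<eta>)"
    using f by (rule bij_betw_cong[THEN iffD1, rotated]) (simp add: t_def)
  have t2: "bij_betw t ({1..d} - supp d ?e) ({1..d} - supp d \<eta>)"
    using g by (rule bij_betw_cong[THEN iffD1, rotated]) (simp add: t_def)
  have t: "bij_betw t {1..d} {1..d}"
    using bij_betw_combine[OF t1 t2] sub by (simp add: Un_absorb1 Un_Diff_cancel)
  let ?M = "\<lambda>j. if \<eta> j = 1 then P1 else P0"
  let ?T = "\<lambda>\<omega>. \<lambda>n\<in>{1..d}. \<omega> (t n)"
  have tM: "?M (t j) = (if ?e j = 1 then P1 else P0)" if "j \<in> {1..d}" for j
  proof -
    have "t j \<in> supp d \<eta> \<longleftrightarrow> j \<in> supp d ?e"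
      using that bij_betwE[OF t1] bij_betwE[OF t2] by blast
    moreover have "t j \<in> {1..d}" using t that by (auto dest: bij_betwE)
    moreover have "\<eta> \<in> binary_vectors d" "?e \<in> binary_vectors d"
      using assms first_ones_sparse[of s d] s by (auto simp: sparse_vectors_def)
    ultimately have "\<eta> (t j) \<in> {0,1}" "?e j \<in> {0,1}" "\<eta> (t j) \<noteq> 0 \<longleftrightarrow> ?e j \<noteq> 0"
      using that by (auto simp: binary_vectors_def supp_def)
    then show ?thesis by auto
  qed
  \<comment> \<open>Permuting the coordinates of a product measure permutes its factors, and by
    \<open>tM\<close> the permuted factors are those of \<open>first_ones d s\<close>.\<close>
  have "distr (Pi\<^sub>M {1..d} ?M) (\<Pi>\<^sub>M i\<in>{1..d}. ?M (t i)) ?T = (\<Pi>\<^sub>M i\<in>{1..d}. ?M (t i))"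
    using t by (intro distr_PiM_reindex)
      (auto simp: P0.prob_space_axioms P1.prob_space_axioms bij_betw_def)
  moreover have "(\<Pi>\<^sub>M i\<in>{1..d}. ?M (t i)) = obs ?e"
    unfolding obs_law_def using tM by (intro PiM_cong) auto
  ultimately have distr: "distr (obs \<eta>) (obs ?e) ?T = obs ?e"
    by (simp add: obs_law_def)
  have T: "?T \<in> measurable (obs \<eta>) (obs ?e)"
  proof -
    have "?T \<in> measurable Obs Obs"
      using t by (intro measurable_restrict measurable_component_singleton) (auto dest: bij_betwE)
    then show ?thesis using measurable_cong_sets[OF sets_obs sets_obs] by blast
  qed
  have "measure (obs ?e) (separated d ?e) = measure (distr (obs \<eta>) (obs ?e) ?T) (separated d ?e)"
    by (simp only: distr)
  also have "\<dots> = measure (obs \<eta>) (?T -` separated d ?e \<inter> space (obs \<eta>))"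
    using T separated_measurable by (intro measure_distr) (auto simp: sets_obs)
  also have "?T -` separated d ?e \<inter> space (obs \<eta>) = separated d \<eta>"
  proof -
    \<comment> \<open>Both quantifiers defining separation for \<eta> are pulled back along
      \<open>t\<close>.\<close>
    have ball: "(\<forall>i\<in>A. P i) \<longleftrightarrow> (\<forall>i\<in>A'. P (t i))" if "bij_betw t A' A" for A A' P
      using that by (auto simp: bij_betw_def)
    have "(\<forall>i\<in>supp d \<eta>. \<forall>j\<in>{1..d} - supp d \<eta>. x j < x i) \<longleftrightarrow>
        (\<forall>i\<in>supp d ?e. \<forall>j\<in>{1..d} - supp d ?e. ?T x j < ?T x i)" for x :: "nat \<Rightarrow> real"
      unfolding ball[OF t1] ball[OF t2] using sub by (auto simp: subset_iff)
    then show ?thesis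
      unfolding separated_def space_obs by (auto simp: space_PiM)
  qed
  finally show ?thesis by simp
qed

definition overlap_prob :: real where
  "overlap_prob = measure (obs (first_ones d s)) {x \<in> space (obs (first_ones d s)).
     (MIN j\<in>{1..s}. x j) \<le> (MAX j\<in>{s+1..d}. x j)}"

lemma prob_separated_first_ones:
  "measure (obs (first_ones d s)) (separated d (first_ones d s)) = 1 - overlap_prob"
proof -
  let ?N = "{x \<in> space Obs. (MIN j\<in>{1..s}. x j) \<le> (MAX j\<in>{s+1..d}. x j)}"
  have "?N = space Obs - separated d (first_ones d s)"
    using s by (auto simp: separated_first_ones)
  then have "?N \<in> sets (obs (first_ones d s))"
    by (simp only: sets_obs sets.compl_sets[OF separated_measurable])
  then have "measure (obs (first_ones d s)) (space (obs (first_ones d s)) - ?N)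
      = 1 - measure (obs (first_ones d s)) ?N"
    by (rule obs.prob_compl)
  then show ?thesis
    unfolding overlap_prob_def separated_first_ones[OF s] space_obs .
qed

section \<open>Risks of selectors\<close>

lemma prob_space_joint:
  assumes "\<sigma> \<in> selectors d" shows "prob_space (joint_law d P0 P1 \<eta> (fst \<sigma>))"
proof -
  interpret Z: prob_space "fst \<sigma>" using assms by (auto simp: selectors_def)
  interpret J: pair_prob_space "obs \<eta>" "fst \<sigma>" ..
  show ?thesis unfolding joint_law_def by unfold_locales
qed

lemma selector_measurable:
  assumes "\<sigma> \<in> selectors d"
  shows "snd \<sigma> \<in> measurable (joint_law d P0 P1 \<eta> (fst \<sigma>)) (count_space (binary_vectors d))"
  unfolding joint_law_def measurable_cong_sets[OF sets_pair_measure_cong[OF sets_obs refl] refl]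
  using assms by (auto simp: selectors_def)

lemma supp_eq_iff:
  assumes "\<sigma> \<in> selectors d" "\<eta> \<in> Sparse" "\<omega> \<in> space (joint_law d P0 P1 \<eta> (fst \<sigma>))"
  shows "supp d (snd \<sigma> \<omega>) = supp d \<eta> \<longleftrightarrow> snd \<sigma> \<omega> = \<eta>"
proof -
  have "snd \<sigma> \<omega> \<in> binary_vectors d"
    using measurable_space[OF selector_measurable[OF assms(1)] assms(3)] by simp
  then show ?thesis
    using assms(2) supp_inj_on[of d] by (auto simp: inj_on_def sparse_vectors_def)
qed

text \<open>A wrong support is the same as a wrong vector by \<open>supp_inj_on\<close>, so failure
  is the complement of the success event in \<open>sum_success_le\<close>.\<close>

lemma wrong_recovery_prob_eq:
  assumes "\<sigma> \<in> selectors d" "\<eta> \<in> Sparse"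
  shows "wrong_recovery_prob d P0 P1 \<sigma> \<eta> = 1 -
    measure (obs \<eta> \<Otimes>\<^sub>M fst \<sigma>) {\<omega> \<in> space (Obs \<Otimes>\<^sub>M fst \<sigma>). snd \<sigma> \<omega> = \<eta>}"
proof -
  let ?J = "joint_law d P0 P1 \<eta> (fst \<sigma>)"
  interpret J: prob_space ?J by (rule prob_space_joint) fact
  let ?R = "{\<omega> \<in> space ?J. snd \<sigma> \<omega> = \<eta>}"
  have "?R = snd \<sigma> -` {\<eta>} \<inter> space ?J" by auto
  also have "\<dots> \<in> sets ?J"
    using assms by (intro measurable_sets[OF selector_measurable]) (auto simp: sparse_vectors_def)
  finally have "J.prob (space ?J - ?R) = 1 - J.prob ?R" by (rule J.prob_compl)
  moreover have "space ?J - ?R = {\<omega> \<in> space ?J. supp d (snd \<sigma> \<omega>) \<noteq> supp d \<eta>}"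
    using supp_eq_iff[OF assms] by auto
  moreover have "space ?J = space (Obs \<Otimes>\<^sub>M fst \<sigma>)"
    by (simp add: joint_law_def space_pair_measure space_obs)
  ultimately show ?thesis
    by (simp add: wrong_recovery_prob_def joint_law_def)
qed

text \<open>This is the Bayes risk bound multiplied by \<open>card Sparse\<close>: by symmetry every
  term on the right of \<open>sum_success_le\<close> equals \<open>1 - overlap_prob\<close>.\<close>

lemma sum_wrong_ge:
  assumes "\<sigma> \<in> selectors d"
  shows "card Sparse * overlap_prob \<le> (\<Sum>\<eta>\<in>Sparse. wrong_recovery_prob d P0 P1 \<sigma> \<eta>)"
proof -
  let ?R = "\<lambda>\<eta>. measure (obs \<eta> \<Otimes>\<^sub>M fst \<sigma>) {\<omega> \<in> space (Obs \<Otimes>\<^sub>M fst \<sigma>). snd \<sigma> \<omega> = \<eta>}"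
  have J: "prob_space (obs \<eta> \<Otimes>\<^sub>M fst \<sigma>)" for \<eta>
    using prob_space_joint[OF assms] unfolding joint_law_def .
  have "(\<Sum>\<eta>\<in>Sparse. emeasure (obs \<eta> \<Otimes>\<^sub>M fst \<sigma>) {\<omega> \<in> space (Obs \<Otimes>\<^sub>M fst \<sigma>). snd \<sigma> \<omega> = \<eta>})
    \<le> (\<Sum>\<eta>\<in>Sparse. emeasure (obs \<eta>) (separated d \<eta>))"
    using assms by (intro sum_success_le) (auto simp: selectors_def)
  then have "ennreal (\<Sum>\<eta>\<in>Sparse. ?R \<eta>) \<le> ennreal (\<Sum>\<eta>\<in>Sparse. measure (obs \<eta>) (separated d \<eta>))"
    by (simp add: finite_measure.emeasure_eq_measure[OF prob_space.finite_measure[OF J]]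
        obs.emeasure_eq_measure sum_ennreal)
  then have "(\<Sum>\<eta>\<in>Sparse. ?R \<eta>) \<le> (\<Sum>\<eta>\<in>Sparse. measure (obs \<eta>) (separated d \<eta>))"
    by (subst (asm) ennreal_le_iff) (auto intro: sum_nonneg)
  also have "\<dots> = card Sparse * (1 - overlap_prob)"
    by (simp add: prob_separated prob_separated_first_ones)
  finally show ?thesis
    by (simp add: wrong_recovery_prob_eq[OF assms] sum_subtractf algebra_simps)
qed

lemma Sparse_nonempty: "Sparse \<noteq> {}"
  using first_ones_sparse[of s d] s by auto

lemma bdd_above_risk: "bdd_above (f ` Sparse)" for f :: "_ \<Rightarrow> real"
  by (intro bdd_above_finite finite_imageI finite_sparse_vectors)

text \<open>The maximum over the finite nonempty set \<open>Sparse\<close> is at least the average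
  under the uniform prior.\<close>

lemma SUP_wrong_ge:
  assumes "\<sigma> \<in> selectors d"
  shows "overlap_prob \<le> (SUP \<eta>\<in>Sparse. wrong_recovery_prob d P0 P1 \<sigma> \<eta>)" (is "_ \<le> ?S")
proof -
  have "card Sparse * overlap_prob \<le> (\<Sum>\<eta>\<in>Sparse. wrong_recovery_prob d P0 P1 \<sigma> \<eta>)"
    by (rule sum_wrong_ge) fact
  also have "\<dots> \<le> (\<Sum>\<eta>\<in>Sparse. ?S)"
    by (intro sum_mono cSUP_upper bdd_above_risk)
  finally have "card Sparse * overlap_prob \<le> card Sparse * ?S" by simp
  moreover have "0 < card Sparse"
    using Sparse_nonempty finite_sparse_vectors by (simp add: card_gt_0_iff)
  ultimately show ?thesis by simp
qed

text \<open>The Hamming distance counts wrong coordinates, so it is at least 1 whenever the supports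
  differ and dominates the indicator of failure.\<close>

lemma wrong_le_hamming:
  assumes "\<sigma> \<in> selectors d"
  shows "wrong_recovery_prob d P0 P1 \<sigma> \<eta> \<le> hamming_risk d P0 P1 \<sigma> \<eta>"
proof -
  let ?J = "joint_law d P0 P1 \<eta> (fst \<sigma>)"
  interpret J: prob_space ?J by (rule prob_space_joint) fact
  let ?W = "{\<omega> \<in> space ?J. supp d (snd \<sigma> \<omega>) \<noteq> supp d \<eta>}"
  note sel = selector_measurable[OF assms]
  have W: "?W \<in> sets ?J"
  proof -
    have "?W = snd \<sigma> -` {\<zeta> \<in> binary_vectors d. supp d \<zeta> \<noteq> supp d \<eta>} \<inter> space ?J"
      using measurable_space[OF sel] by auto
    also have "\<dots> \<in> sets ?J" by (rule measurable_sets[OF sel]) auto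
    finally show ?thesis .
  qed
  have ham: "(\<lambda>\<omega>. hamming d (snd \<sigma> \<omega>) \<eta>) \<in> borel_measurable ?J"
    using measurable_compose[OF sel, of "\<lambda>\<zeta>. hamming d \<zeta> \<eta>" borel] by simp
  have bnd: "hamming d \<zeta> \<eta> \<le> real d" for \<zeta>
    unfolding hamming_def using sum_bounded_above[of "{1..d}" "\<lambda>j. of_bool (\<zeta> j \<noteq> \<eta> j)" "1::real"] by simp
  have nn: "0 \<le> hamming d \<zeta> \<eta>" for \<zeta>
    unfolding hamming_def by (intro sum_nonneg) auto
  \<comment> \<open>Integrability has to be secured, since the integral of a non-integrable function
    is 0 by default; the bound \<open>d\<close> suffices under a probability measure.\<close>
  have int: "integrable ?J (\<lambda>\<omega>. hamming d (snd \<sigma> \<omega>) \<eta>)"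
    using bnd nn ham by (intro J.integrable_const_bound[where B = "real d"]) auto
  have ge1: "1 \<le> hamming d \<zeta> \<eta>" if neq: "supp d \<zeta> \<noteq> supp d \<eta>" for \<zeta>
  proof -
    have "supp d \<zeta> = supp d \<eta>" if "\<forall>j\<in>{1..d}. \<zeta> j = \<eta> j"
      using that by (auto simp: supp_def)
    then obtain j where j: "j \<in> {1..d}" "\<zeta> j \<noteq> \<eta> j"
      using neq by blast
    then have "1 = of_bool (\<zeta> j \<noteq> \<eta> j)" by simp
    also have "\<dots> \<le> hamming d \<zeta> \<eta>"
      unfolding hamming_def using j(1) by (intro member_le_sum) auto
    finally show ?thesis .
  qed
  have "wrong_recovery_prob d P0 P1 \<sigma> \<eta> = (\<integral>\<omega>. indicator ?W \<omega> \<partial>?J)"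
    using W by (simp add: wrong_recovery_prob_def)
  also have "\<dots> \<le> (\<integral>\<omega>. hamming d (snd \<sigma> \<omega>) \<eta> \<partial>?J)"
    using W int nn ge1 by (intro integral_mono) (auto simp: indicator_def intro: J.integrable_const_bound[where B = 1])
  finally show ?thesis by (simp add: hamming_risk_def)
qed

lemma SUP_wrong_le_hamming:
  assumes "\<sigma> \<in> selectors d"
  shows "(SUP \<eta>\<in>Sparse. wrong_recovery_prob d P0 P1 \<sigma> \<eta>) \<le> (SUP \<eta>\<in>Sparse. hamming_risk d P0 P1 \<sigma> \<eta>)"
  using wrong_le_hamming[OF assms] Sparse_nonempty bdd_above_risk by (intro cSUP_mono) auto

text \<open>Comparing real infima requires a lower bound for the smaller family, supplied by
  \<open>overlap_prob\<close>.\<close>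

lemma INF_wrong_le_hamming:
  "(INF \<sigma>\<in>(selectors d :: 'z selector set). SUP \<eta>\<in>Sparse. wrong_recovery_prob d P0 P1 \<sigma> \<eta>)
    \<le> (INF \<sigma>\<in>(selectors d :: 'z selector set). SUP \<eta>\<in>Sparse. hamming_risk d P0 P1 \<sigma> \<eta>)"
  using SUP_wrong_le_hamming SUP_wrong_ge
  by (intro cINF_mono selectors_nonempty bdd_belowI2[of _ overlap_prob]) auto

lemma INF_wrong_ge:
  "overlap_prob \<le> (INF \<sigma>\<in>(selectors d :: 'z selector set). SUP \<eta>\<in>Sparse. wrong_recovery_prob d P0 P1 \<sigma> \<eta>)"
  by (intro cINF_greatest selectors_nonempty SUP_wrong_ge)

section \<open>Independence of coordinates and absence of atoms\<close>

lemma box_measurable: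
  assumes "\<And>j. j \<in> {1..d} \<Longrightarrow> A j \<in> sets borel"
  shows "{x \<in> space Obs. \<forall>j\<in>{1..d}. x j \<in> A j} \<in> sets Obs"
proof -
  have "{x \<in> space Obs. \<forall>j\<in>{1..d}. x j \<in> A j} = Pi\<^sub>E {1..d} A"
    by (auto simp: space_PiM PiE_iff extensional_def)
  also have "\<dots> \<in> sets Obs" using assms by (intro sets_PiM_I_finite) auto
  finally show ?thesis .
qed

text \<open>Independence in the form used below: taking \<open>UNIV\<close> for some
  \<open>A j\<close> leaves that coordinate free and contributes the factor 1.\<close>

lemma prob_box:
  assumes "\<And>j. j \<in> {1..d} \<Longrightarrow> A j \<in> sets borel"
  shows "measure (obs \<eta>) {x \<in> space Obs. \<forall>j\<in>{1..d}. x j \<in> A j}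
    = (\<Prod>j\<in>{1..d}. if \<eta> j = 1 then measure P1 (A j) else measure P0 (A j))"
proof -
  let ?M = "\<lambda>j. if \<eta> j = 1 then P1 else P0"
  have M: "product_prob_space ?M"
    by (intro product_prob_spaceI) (auto intro: P0.prob_space_axioms P1.prob_space_axioms)
  interpret finite_product_prob_space ?M "{1..d}"
    by (intro finite_product_prob_space.intro finite_product_sigma_finite.intro
        finite_product_sigma_finite_axioms.intro M product_prob_space.axioms(1)[OF M]) simp
  have eq: "{x \<in> space Obs. \<forall>j\<in>{1..d}. x j \<in> A j} = Pi\<^sub>E {1..d} A"
    by (auto simp: space_PiM PiE_iff extensional_def)
  show ?thesis
    unfolding obs_law_def eq using assms by (subst finite_measure_PiM_emb) (auto intro!: prod.cong)
qed

text \<open>If the laws of two different coordinates both charged \<open>a\<close>, independence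
  would make these coordinates tie at \<open>a\<close> with positive probability, against
  distinctness.\<close>

lemma no_common_atom:
  assumes "i \<in> {1..d}" "j \<in> {1..d}" "i \<noteq> j" "\<eta> \<in> Sparse"
  shows "(if \<eta> i = 1 then measure P1 {a} else measure P0 {a})
    * (if \<eta> j = 1 then measure P1 {a} else measure P0 {a}) = 0"
proof -
  let ?A = "\<lambda>k. if k = i \<or> k = j then {a} else UNIV"
  let ?f = "\<lambda>k. if \<eta> k = 1 then measure P1 (?A k) else measure P0 (?A k)"
  have "AE x in obs \<eta>. inj_on x {1..d}"
    using distinct assms(4) by (simp add: as_distinct_def)
  then have "AE x in obs \<eta>. x \<notin> {x \<in> space Obs. \<forall>k\<in>{1..d}. x k \<in> ?A k}"
  proof eventually_elim
    case (elim x)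
    show ?case
    proof
      assume "x \<in> {x \<in> space Obs. \<forall>k\<in>{1..d}. x k \<in> ?A k}"
      then have "x k \<in> ?A k" if "k \<in> {1..d}" for k using that by blast
      from this[OF assms(1)] this[OF assms(2)] have "x i = a" "x j = a" by simp_all
      then show False using elim assms by (auto dest: inj_onD)
    qed
  qed
  moreover have "{x \<in> space Obs. \<forall>k\<in>{1..d}. x k \<in> ?A k} \<in> obs.events \<eta>"
    unfolding sets_obs by (rule box_measurable) simp
  ultimately have "measure (obs \<eta>) {x \<in> space Obs. \<forall>k\<in>{1..d}. x k \<in> ?A k} = 0"
    using obs.prob_eq_0 by blast
  moreover have "measure (obs \<eta>) {x \<in> space Obs. \<forall>k\<in>{1..d}. x k \<in> ?A k} = prod ?f {1..d}"
    by (rule prob_box) simp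
  moreover have "prod ?f {1..d} = prod ?f {i, j}"
    using assms P0.prob_space P1.prob_space
    by (intro prod.mono_neutral_right) auto
  ultimately have "prod ?f {i, j} = 0" by (simp only:)
  then show ?thesis using assms(3) by (simp cong: if_cong)
qed

text \<open>Under \<open>first_ones d s\<close> the bounds on \<open>s\<close> leave two noise
  coordinates, \<open>d - 1\<close> and \<open>d\<close>, and two signal coordinates, 1 and 2. Each
  pair makes the square of an atom's mass vanish.\<close>

lemma atomless:
  assumes "2 \<le> s" "s \<le> d - 2" shows "measure P0 {a} = 0" "measure P1 {a} = 0"
proof -
  have "\<not> d - 1 \<le> s" "\<not> d \<le> s" "d - 1 \<noteq> d" "1 \<le> d - 1" using assms s by linarith+
  then show "measure P0 {a} = 0" "measure P1 {a} = 0"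
    using no_common_atom[of "d - 1" d "first_ones d s" a] no_common_atom[of 1 2 "first_ones d s" a]
    first_ones_sparse[of s d] assms s
    by (auto simp: first_ones_def)
qed

section \<open>The quantile bound\<close>

text \<open>Separation forces all signals above \<open>u\<close> (event \<open>?A\<close>) or all
  noise at most \<open>v\<close> (event \<open>?B\<close>). These events are independent with
  probabilities \<open>a\<close> and \<open>b\<close>, so their union misses mass
  \<open>(1 - a) * (1 - b)\<close>.\<close>

lemma overlap_prob_ge:
  assumes s2: "2 \<le> s" "s \<le> d - 2"
    and q: "quantile P1 (1 / real s) < quantile P0 (1 - 1 / real (d - s))"
  shows "(1 - exp (- 1))\<^sup>2 \<le> overlap_prob"
proof -
  define u where "u = quantile P1 (1 / real s)"
  define n where "n = d - s"
  define v where "v = quantile P0 (1 - 1 / real n)"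
  have n: "2 \<le> n" using assms s by (auto simp: n_def)
  let ?e = "first_ones d s"
  let ?box = "\<lambda>A. {x \<in> space Obs. \<forall>j\<in>{1..d}. x j \<in> A j}"
  let ?A = "?box (\<lambda>j. if j \<le> s then {u<..} else UNIV)"
  let ?B = "?box (\<lambda>j. if j \<le> s then UNIV else {..v})"
  let ?AB = "?box (\<lambda>j. if j \<le> s then {u<..} else {..v})"
  \<comment> \<open>Absence of atoms is what makes the quantile levels exact.\<close>
  have cu: "measure P1 {..u} = 1 / real s"
    using P1.cdf_quantile[of "1 / real s"] atomless[OF s2] s2 by (simp add: u_def cdf_def)
  have "{u<..} = space P1 - {..u}" by auto
  then have u: "measure P1 {u<..} = 1 - 1 / real s"
    using P1.prob_compl[of "{..u}"] cu by simp
  have v: "measure P0 {..v} = 1 - 1 / real n"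
    using P0.cdf_quantile[of "1 - 1 / real n"] atomless[OF s2] n by (simp add: v_def cdf_def)
  have prod: "(\<Prod>j\<in>{1..d}. if ?e j = 1 then a else b) = a ^ s * b ^ n" for a b :: real
  proof -
    have "{1..d} = {1..s} \<union> {s<..d}" using s by auto
    then have "(\<Prod>j\<in>{1..d}. if ?e j = 1 then a else b)
        = (\<Prod>j\<in>{1..s} \<union> {s<..d}. if ?e j = 1 then a else b)" by (rule prod.cong) simp
    also have "\<dots> = (\<Prod>j\<in>{1..s}. if ?e j = 1 then a else b) * (\<Prod>j\<in>{s<..d}. if ?e j = 1 then a else b)"
      by (intro prod.union_disjoint) auto
    also have "(\<Prod>j\<in>{1..s}. if ?e j = 1 then a else b) = (\<Prod>j\<in>{1..s}. a)"
      using s by (intro prod.cong) (auto simp: first_ones_def)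
    also have "(\<Prod>j\<in>{s<..d}. if ?e j = 1 then a else b) = (\<Prod>j\<in>{s<..d}. b)"
      by (intro prod.cong) (auto simp: first_ones_def)
    finally show ?thesis by (simp add: n_def)
  qed
  have box: "measure (obs ?e) (?box (\<lambda>j. if j \<le> s then S else T)) = measure P1 S ^ s * measure P0 T ^ n"
    if "S \<in> sets borel" "T \<in> sets borel" for S T
  proof -
    have "measure (obs ?e) (?box (\<lambda>j. if j \<le> s then S else T))
        = (\<Prod>j\<in>{1..d}. if ?e j = 1 then measure P1 S else measure P0 T)"
      using that by (subst prob_box) (auto simp: first_ones_def intro!: prod.cong)
    then show ?thesis using prod by simp
  qed
  define a where "a = (1 - 1 / real s) ^ s"
  define b where "b = (1 - 1 / real n) ^ n"
  have mA: "measure (obs ?e) ?A = a"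
    using box[of "{u<..}" UNIV] u P0.prob_space by (simp add: a_def)
  have mB: "measure (obs ?e) ?B = b"
    using box[of UNIV "{..v}"] v P1.prob_space by (simp add: b_def)
  have mAB: "measure (obs ?e) ?AB = a * b"
    using box[of "{u<..}" "{..v}"] u v by (simp add: a_def b_def)
  have sets: "?A \<in> obs.events ?e" "?B \<in> obs.events ?e" "?A \<union> ?B \<in> obs.events ?e"
    unfolding sets_obs by (intro sets.Un box_measurable; simp)+
  \<comment> \<open>The intersection is again a box, so its probability factorises and
    inclusion-exclusion applies.\<close>
  have "?A \<inter> ?B = ?AB" by (auto split: if_splits)
  then have "measure (obs ?e) (?A \<union> ?B) = a + b - a * b"
    using obs.finite_measure_Union'[of ?A ?e ?B] obs.finite_measure_Diff'[of ?B ?e ?A] sets mA mB mAB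
    by (simp add: Int_commute)
  \<comment> \<open>If both events fail, some signal is at most \<open>u\<close> and some noise
    exceeds \<open>v\<close>; with \<open>u < v\<close> this noise lies above this signal.\<close>
  moreover have "separated d ?e \<subseteq> ?A \<union> ?B"
  proof (rule ccontr)
    assume "\<not> ?thesis"
    then obtain x where x: "x \<in> separated d ?e" "x \<notin> ?A" "x \<notin> ?B" by blast
    have "x \<in> space Obs" using x(1) by (simp add: separated_def)
    with x obtain i where "i \<in> {1..s}" "x i \<le> u"
      by (auto split: if_splits)
    moreover from \<open>x \<in> space Obs\<close> x obtain j where "j \<in> {s<..d}" "v < x j"
      by (auto simp: not_le split: if_splits)
    moreover from calculation have "x j < x i"
      using x(1) s by (simp add: separated_def supp_first_ones)
    ultimately show False using q by (simp add: u_def v_def n_def)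
  qed
  then have "1 - overlap_prob \<le> measure (obs ?e) (?A \<union> ?B)"
    unfolding prob_separated_first_ones[symmetric] using sets by (intro obs.finite_measure_mono)
  ultimately have "(1 - a) * (1 - b) \<le> overlap_prob" by (simp add: algebra_simps)
  moreover have "a \<le> exp (-1)" "b \<le> exp (-1)"
    unfolding a_def b_def using n s by (auto intro: one_minus_inverse_power_le)
  then have "(1 - exp (-1)) * (1 - exp (-1)) \<le> (1 - a) * (1 - b)"
    by (intro mult_mono) (auto simp: order_trans[of a "exp (-1)" 1])
  ultimately show ?thesis by (simp add: power2_eq_square)
qed

end

section \<open>Return to densities, and the asymptotic statement\<close>

lemma monotone_selection:
  assumes prob: "selection_problem d s \<mu> f0 f1 P0 P1" and "as_distinct d s P0 P1" and MLR: "MLR f0 f1"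
  shows "monotone_selection d s P0 P1 (\<lambda>x. f1 x / f0 x)"
proof -
  have [measurable]: "f0 \<in> borel_measurable borel" "f1 \<in> borel_measurable borel"
    and \<mu>: "sets \<mu> = sets borel"
    and nn: "\<And>x. 0 \<le> f0 x" "\<And>x. 0 \<le> f1 x"
    and P0: "P0 = density \<mu> (\<lambda>x. ennreal (f0 x))" and P1: "P1 = density \<mu> (\<lambda>x. ennreal (f1 x))"
    using prob by (auto simp: selection_problem_def)
  note [measurable_cong] = \<mu>
  have supp: "0 < f0 x \<longleftrightarrow> 0 < f1 x" for x
    using MLR by (auto simp: MLR_def set_eq_iff)
  have pos: "0 < f1 x / f0 x \<longleftrightarrow> 0 < f0 x" for x
    using supp[of x] nn[of x] by (auto simp: zero_less_divide_iff)
  have m0: "(\<lambda>x. ennreal (f0 x)) \<in> borel_measurable \<mu>"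
    and m1: "(\<lambda>x. ennreal (f1 x / f0 x)) \<in> borel_measurable \<mu>" by measurable
  show ?thesis
  proof (rule monotone_selection.intro)
    show "1 \<le> s" "s < d" "real_distribution P0" "real_distribution P1" "as_distinct d s P0 P1"
      using assms by (auto simp: selection_problem_def)
    show "(\<lambda>x. f1 x / f0 x) \<in> borel_measurable borel" by measurable
    show "0 \<le> f1 x / f0 x" for x using nn by simp
    show "AE x in P0. 0 < f1 x / f0 x"
      unfolding P0 pos using m0 by (subst AE_density) auto
    show "strict_mono_on {x. 0 < f1 x / f0 x} (\<lambda>x. f1 x / f0 x)"
      unfolding pos using MLR unfolding MLR_def by (rule conjunct2)
    \<comment> \<open>Where \<open>f0\<close> vanishes so does \<open>f1\<close>, by the common
      support; the identity therefore holds at every point.\<close>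
    have "ennreal (f0 x) * ennreal (f1 x / f0 x) = ennreal (f1 x)" for x
      using supp[of x] nn[of x] by (cases "f0 x = 0") (auto simp: ennreal_mult[symmetric] less_le)
    then show "P1 = density P0 (\<lambda>x. ennreal (f1 x / f0 x))"
      unfolding P0 P1 using m0 m1 by (subst density_density_eq) auto
  qed
qed

theorem corollary2:
  "(\<forall>(d::nat) (s::nat) \<mu> f0 f1 P0 P1.
      selection_problem d s \<mu> f0 f1 P0 P1 \<and> as_distinct d s P0 P1 \<and> MLR f0 f1 \<longrightarrow>
        (INF \<sigma>\<in>(selectors d :: 'z selector set). SUP \<eta>\<in>sparse_vectors d s. hamming_risk d P0 P1 \<sigma> \<eta>)
          \<ge> (INF \<sigma>\<in>(selectors d :: 'z selector set). SUP \<eta>\<in>sparse_vectors d s. wrong_recovery_prob d P0 P1 \<sigma> \<eta>) \<and>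
        (INF \<sigma>\<in>(selectors d :: 'z selector set). SUP \<eta>\<in>sparse_vectors d s. wrong_recovery_prob d P0 P1 \<sigma> \<eta>)
          \<ge> measure (obs_law d P0 P1 (first_ones d s))
              {x \<in> space (obs_law d P0 P1 (first_ones d s)).
                 (MIN j\<in>{1..s}. x j) \<le> (MAX j\<in>{s+1..d}. x j)} \<and>
        (2 \<le> s \<and> s \<le> d - 2 \<and> quantile P0 (1 - 1 / real (d - s)) > quantile P1 (1 / real s) \<longrightarrow>
          (INF \<sigma>\<in>(selectors d :: 'z selector set). SUP \<eta>\<in>sparse_vectors d s. hamming_risk d P0 P1 \<sigma> \<eta>)
            \<ge> (INF \<sigma>\<in>(selectors d :: 'z selector set). SUP \<eta>\<in>sparse_vectors d s. wrong_recovery_prob d P0 P1 \<sigma> \<eta>) \<and>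
          (INF \<sigma>\<in>(selectors d :: 'z selector set). SUP \<eta>\<in>sparse_vectors d s. wrong_recovery_prob d P0 P1 \<sigma> \<eta>)
            \<ge> (1 - exp (- 1))\<^sup>2)) \<and>
   (\<forall>(s :: nat \<Rightarrow> nat) \<mu> f0 f1 P0 P1.
      (\<forall>\<^sub>F d in sequentially. 2 \<le> s d \<and> s d \<le> d - 2) \<and>
      (\<forall>d>2. selection_problem d (s d) (\<mu> d) (f0 d) (f1 d) (P0 d) (P1 d) \<and>
             as_distinct d (s d) (P0 d) (P1 d) \<and> MLR (f0 d) (f1 d)) \<and>
      (\<exists>\<sigma> :: nat \<Rightarrow> 'z selector. exact_recovery s P0 P1 \<sigma>) \<longrightarrow>
      (\<forall>\<^sub>F d in sequentially.
         quantile (P0 d) (1 - 1 / real (d - s d)) \<le> quantile (P1 d) (1 / real (s d))))"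
  (is "?bounds \<and> ?necessity")
proof
  show ?bounds
  proof (intro allI impI, elim conjE)
    fix d s \<mu> f0 f1 P0 P1
    assume "selection_problem d s \<mu> f0 f1 P0 P1" "as_distinct d s P0 P1" "MLR f0 f1"
    then interpret monotone_selection d s P0 P1 "\<lambda>x. f1 x / f0 x" by (rule monotone_selection)
    let ?H = "INF \<sigma>\<in>(selectors d :: 'z selector set). SUP \<eta>\<in>sparse_vectors d s. hamming_risk d P0 P1 \<sigma> \<eta>"
    let ?W = "INF \<sigma>\<in>(selectors d :: 'z selector set). SUP \<eta>\<in>sparse_vectors d s. wrong_recovery_prob d P0 P1 \<sigma> \<eta>"
    show "?W \<le> ?H \<and>
        measure (obs_law d P0 P1 (first_ones d s))
              {x \<in> space (obs_law d P0 P1 (first_ones d s)).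
                 (MIN j\<in>{1..s}. x j) \<le> (MAX j\<in>{s+1..d}. x j)} \<le> ?W \<and>
        (2 \<le> s \<and> s \<le> d - 2 \<and> quantile P0 (1 - 1 / real (d - s)) > quantile P1 (1 / real s) \<longrightarrow>
          ?W \<le> ?H \<and> (1 - exp (- 1))\<^sup>2 \<le> ?W)"
      using INF_wrong_le_hamming INF_wrong_ge overlap_prob_ge order_trans[OF overlap_prob_ge INF_wrong_ge]
      unfolding overlap_prob_def by blast
  qed
next
  show ?necessity
  proof (intro allI impI, elim conjE exE)
    fix s :: "nat \<Rightarrow> nat" and \<mu> f0 f1 P0 P1 and \<sigma> :: "nat \<Rightarrow> 'z selector"
    assume ev: "\<forall>\<^sub>F d in sequentially. 2 \<le> s d \<and> s d \<le> d - 2"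
      and prob: "\<forall>d>2. selection_problem d (s d) (\<mu> d) (f0 d) (f1 d) (P0 d) (P1 d) \<and>
             as_distinct d (s d) (P0 d) (P1 d) \<and> MLR (f0 d) (f1 d)"
      and exact: "exact_recovery s P0 P1 \<sigma>"
    let ?R = "\<lambda>d. SUP \<eta>\<in>sparse_vectors d (s d). hamming_risk d (P0 d) (P1 d) (\<sigma> d) \<eta>"
    let ?c = "(1 - exp (- 1))\<^sup>2 :: real"
    \<comment> \<open>Exact recovery makes the limsup 0, and \<open>?c\<close> is positive, so the
      maximal risk eventually falls below \<open>?c\<close>.\<close>
    have "limsup (\<lambda>d. ereal (?R d)) < ereal ?c"
      using exact by (simp add: exact_recovery_def)
    then have "\<forall>\<^sub>F d in sequentially. ereal (?R d) < ereal ?c"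
      by (rule Limsup_lessD)
    then show "\<forall>\<^sub>F d in sequentially.
        quantile (P0 d) (1 - 1 / real (d - s d)) \<le> quantile (P1 d) (1 / real (s d))"
      using ev eventually_gt_at_top[of 2]
    proof eventually_elim
      case (elim d)
      then interpret monotone_selection d "s d" "P0 d" "P1 d" "\<lambda>x. f1 d x / f0 d x"
        using prob by (intro monotone_selection) auto
      have "\<sigma> d \<in> selectors d" using exact elim by (simp add: exact_recovery_def)
      \<comment> \<open>The bounds hold for each selector separately, so no infimum is involved. A
        reversed quantile inequality would give \<open>overlap_prob\<close> at least
        \<open>?c\<close>, a contradiction.\<close>
      then have "overlap_prob \<le> ?R d"
        using SUP_wrong_ge SUP_wrong_le_hamming order_trans by blast
      then have "overlap_prob < ?c" using elim by simp
      then show ?case using overlap_prob_ge elim by force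
    qed
  qed
qed

end
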